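(* Let $Q\subset\otimes_{i=1}^{l}\mathbb{R}^{d_{i}}$ be a $0$-symmetric convex body. Then there exist norms $\left\Vert \cdot\right\Vert _{i}$ on $\mathbb{R}^{d_{i}}$, $i=1,\ldots,l$, such that $Q$ is the closed unit ball of a reasonable crossnorm on $\otimes_{i=1}^{l}\left(\mathbb{R}^{d_{i}},\left\Vert \cdot\right\Vert _{i}\right)$ if and only if for an arbitrary (i.e. every) decomposable vector $a^{1}\otimes\cdots\otimes a^{l}\in\partial Q$ it holds that $$Q_{1}^{a^{1},\ldots,a^{l}}\otimes_{\pi}\cdots\otimes_{\pi}Q_{l}^{a^{1},\ldots, a^{l}}\subseteq Q\subseteq Q_{1}^{a^{1},\ldots,a^{l}}\otimes_{\epsilon}\cdots\otimes_{\epsilon}Q_{l}^{a^{1},\ldots,a^{l}}.$$ In such a situation, $Q_{i}^{a^{1},\ldots,a^{l}}=\left\Vert a^i\right\Vert _{i}B_{\left(\mathbb{R}^{d_{i}},\left\Vert \cdot\right\Vert _{i}\right)}$ for $i=1,\dots,l$, where $B_{(\mathbb{R}^{d_i},\|\cdot\|_i)}$ is the closed unit ball of $(\mathbb{R}^{d_i},\|\cdot\|_i)$.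
   Context: Here $l$ and $d_1,\dots,d_l$ are positive integers. $\langle\cdot,\cdot\rangle$ is the standard scalar product on $\mathbb{R}^{d}$, and $\langle\cdot,\cdot\rangle_H$ is the scalar product on $\otimes_{i=1}^l\mathbb{R}^{d_i}$ determined by $\langle x^1\otimes\cdots\otimes x^l,y^1\otimes\cdots\otimes y^l\rangle_H=\prod_{i=1}^l\langle x^i,y^i\rangle$. In a Euclidean space $\mathbb{E}$, a convex body is a compact convex set with nonempty interior; it is $0$-symmetric if $P=-P$. The polar set of a nonempty $C\subset\mathbb{E}$ is $C^\circ=\{y\in\mathbb{E}:\sup_{x\in C}|\langle x,y\rangle_{\mathbb{E}}|\le 1\}$ (with $\langle\cdot,\cdot\rangle$ in $\mathbb{R}^{d_i}$ and $\langle\cdot,\cdot\rangle_H$ in the tensor product). For $0$-symmetric convex bodies $Q_i\subset\mathbb{R}^{d_i}$: $Q_1\otimes_\pi\cdots\otimes_\pi Q_l:=\mathrm{conv}\{x^1\otimes\cdots\otimes x^l:x^i\in Q_i,\ i=1,\dots,l\}$ and $Q_1\otimes_\epsilon\cdots\otimes_\epsilon Q_l:=(Q_1^\circ\otimes_\pi\cdots\otimes_\pi Q_l^\circ)^\circ$. For a $0$-symmetric convex body $Q\subset\otimes_{i=1}^l\mathbb{R}^{d_i}$ and a non-zero decomposable vector $a^1\otimes\cdots\otimes a^l$, the $0$-symmetric convex bodies $Q_i^{a^1,\dots,a^l}\subset\mathbb{R}^{d_i}$ are $$Q_{i}^{a^{1},\ldots,a^{l}}:=\left\{ x^{i}\in\mathbb{R}^{d_{i}}:a^{1}\otimes\cdots\otimes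 a^{i-1}\otimes x^{i}\otimes a^{i+1}\otimes\cdots\otimes a^{l}\in Q\right\}.$$ A norm $\alpha$ on the tensor product $\otimes_{i=1}^l X_i$ of normed spaces is a reasonable crossnorm if (1) $\alpha(x^1\otimes\cdots\otimes x^l)\le\|x^1\|\cdots\|x^l\|$ for all $x^i\in X_i$, and (2) for all $x_i^*\in X_i^*$, $x_1^*\otimes\cdots\otimes x_l^*\in(\otimes_{i=1}^lX_i,\alpha)^*$ and its dual norm is at most $\|x_1^*\|\cdots\|x_l^*\|$. *)

theory Defs
  imports "HOL-Analysis.Analysis"
begin

text \<open>
  The number of factors is the cardinality of the index type \<open>'l\<close>. As the dimensions vary with the
  factor, the factor of index \<open>i\<close> is the coordinate subspace of \<open>real ^ 'n\<close> of the vectors supported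
  on a nonempty set \<open>J i\<close> of coordinates, i.e. a copy of Euclidean space of dimension \<open>card (J i)\<close>.
  Since \<open>'l\<close>, \<open>'n\<close> and \<open>J\<close> are arbitrary, every finite family of positive dimensions occurs.
  The tensor product consists of the arrays indexed by the multi-indices \<open>m\<close> with \<open>m i \<in> J i\<close>;
  these form a coordinate subspace of \<open>real ^ ('l \<Rightarrow> 'n)\<close>, on which the ambient inner product is
  the scalar product of the tensor product (lemma \<open>inner_tensor\<close>).
\<close>

definition coord_space :: "'k::finite set \<Rightarrow> (real ^ 'k) set" where
  "coord_space I = {x. \<forall>k. k \<notin> I \<longrightarrow> x $ k = 0}"

definition tensor_space :: "('l::finite \<Rightarrow> 'n::finite set) \<Rightarrow> (real ^ ('l \<Rightarrow> 'n)) set" where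
  "tensor_space J = coord_space {m. \<forall>i. m i \<in> J i}"

definition tensor :: "('l::finite \<Rightarrow> real ^ 'n::finite) \<Rightarrow> real ^ ('l \<Rightarrow> 'n)" where
  "tensor x = (\<chi> m. \<Prod>i\<in>UNIV. x i $ m i)"

lemma tensor_in_tensor_space:
  fixes x :: "'l::finite \<Rightarrow> real ^ 'n::finite"
  assumes "\<And>i. x i \<in> coord_space (J i)"
  shows "tensor x \<in> tensor_space J"
  using assms by (auto simp: tensor_def tensor_space_def coord_space_def)

lemma inner_tensor:
  fixes x y :: "'l::finite \<Rightarrow> real ^ 'n::finite"
  shows "tensor x \<bullet> tensor y = (\<Prod>i\<in>UNIV. x i \<bullet> y i)"
proof -
  have "(\<Prod>i\<in>UNIV. x i \<bullet> y i) = (\<Sum>m\<in>PiE UNIV (\<lambda>_. UNIV). \<Prod>i\<in>UNIV. x i $ m i * y i $ m i)"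
    unfolding inner_vec_def inner_real_def by (rule prod_sum_PiE) auto
  then show ?thesis
    by (simp add: inner_vec_def tensor_def prod.distrib)
qed

lemma tensor_axis:
  "tensor (\<lambda>i. axis (m i) 1) = (axis m 1 :: real ^ ('l::finite \<Rightarrow> 'n::finite))"
proof -
  have "(\<Prod>i\<in>UNIV. axis (m i) (1::real) $ m' i) = axis m 1 $ m'" for m' :: "'l \<Rightarrow> 'n"
  proof (cases "m' = m")
    case False
    then obtain i where "m' i \<noteq> m i" by auto
    then show ?thesis using False by (auto simp: axis_def)
  qed (simp add: axis_def)
  then show ?thesis by (simp add: tensor_def vec_eq_iff)
qed

lemma subspace_coord_space: "subspace (coord_space I)"
  by (auto simp: subspace_def coord_space_def)

lemma span_tensor:
  fixes J :: "'l::finite \<Rightarrow> 'n::finite set"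
  shows "span {tensor x | x. \<forall>i. x i \<in> coord_space (J i)} = tensor_space J"
proof
  show "span {tensor x | x. \<forall>i. x i \<in> coord_space (J i)} \<subseteq> tensor_space J"
  proof (rule span_minimal)
    show "{tensor x | x. \<forall>i. x i \<in> coord_space (J i)} \<subseteq> tensor_space J"
      by (auto intro: tensor_in_tensor_space)
    show "subspace (tensor_space J)"
      by (simp add: tensor_space_def subspace_coord_space)
  qed
  show "tensor_space J \<subseteq> span {tensor x | x. \<forall>i. x i \<in> coord_space (J i)}"
  proof
    fix z assume z: "z \<in> tensor_space J"
    have "z $ m *\<^sub>R axis m 1 \<in> span {tensor x | x. \<forall>i. x i \<in> coord_space (J i)}" for m
    proof (cases "\<forall>i. m i \<in> J i")
      case True
      then have "\<forall>i. axis (m i) (1::real) \<in> coord_space (J i)"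
        by (auto simp: coord_space_def axis_def)
      then have "axis m 1 \<in> {tensor x | x. \<forall>i. x i \<in> coord_space (J i)}"
        unfolding tensor_axis[symmetric] by blast
      then show ?thesis by (intro span_scale span_base)
    next
      case False
      then have "z $ m = 0" using z by (auto simp: tensor_space_def coord_space_def)
      then show ?thesis by (simp add: span_zero)
    qed
    then have "(\<Sum>m\<in>UNIV. z $ m *\<^sub>R axis m 1) \<in> span {tensor x | x. \<forall>i. x i \<in> coord_space (J i)}"
      by (intro span_sum)
    moreover have "(\<Sum>m\<in>UNIV. z $ m *\<^sub>R axis m 1) = z"
      using basis_expansion[of z] by (simp add: scalar_mult_eq_scaleR)
    ultimately show "z \<in> span {tensor x | x. \<forall>i. x i \<in> coord_space (J i)}" by simp
  qed
qed

text \<open>The topological notions below are those of the subspace \<open>V\<close>, not of the ambient type.\<close>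

definition symmetric_convex_body :: "'a::euclidean_space set \<Rightarrow> 'a set \<Rightarrow> bool" where
  "symmetric_convex_body V K \<longleftrightarrow>
     K \<subseteq> V \<and> compact K \<and> convex K \<and> (top_of_set V) interior_of K \<noteq> {} \<and> uminus ` K = K"

definition polar :: "'a::euclidean_space set \<Rightarrow> 'a set \<Rightarrow> 'a set" where
  "polar V C = {y \<in> V. (SUP x\<in>C. ereal \<bar>x \<bullet> y\<bar>) \<le> 1}"

definition proj_tensor ::
    "('l::finite \<Rightarrow> (real ^ 'n::finite) set) \<Rightarrow> (real ^ ('l \<Rightarrow> 'n)) set" where
  "proj_tensor K = convex hull {tensor x | x. \<forall>i. x i \<in> K i}"

definition inj_tensor :: "('l::finite \<Rightarrow> 'n::finite set) \<Rightarrow> ('l \<Rightarrow> (real ^ 'n) set)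
    \<Rightarrow> (real ^ ('l \<Rightarrow> 'n)) set" where
  "inj_tensor J K = polar (tensor_space J) (proj_tensor (\<lambda>i. polar (coord_space (J i)) (K i)))"

definition factor_body :: "('l::finite \<Rightarrow> 'n::finite set) \<Rightarrow> (real ^ ('l \<Rightarrow> 'n)) set
    \<Rightarrow> ('l \<Rightarrow> real ^ 'n) \<Rightarrow> 'l \<Rightarrow> (real ^ 'n) set" where
  "factor_body J Q a i = {x \<in> coord_space (J i). tensor (a(i := x)) \<in> Q}"

definition norm_on :: "'a::real_vector set \<Rightarrow> ('a \<Rightarrow> real) \<Rightarrow> bool" where
  "norm_on V \<nu> \<longleftrightarrow>
     (\<forall>x\<in>V. 0 \<le> \<nu> x) \<and> (\<forall>x\<in>V. \<nu> x = 0 \<longleftrightarrow> x = 0) \<and>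
     (\<forall>c. \<forall>x\<in>V. \<nu> (c *\<^sub>R x) = \<bar>c\<bar> * \<nu> x) \<and>
     (\<forall>x\<in>V. \<forall>y\<in>V. \<nu> (x + y) \<le> \<nu> x + \<nu> y)"

definition unit_ball_on :: "'a::real_vector set \<Rightarrow> ('a \<Rightarrow> real) \<Rightarrow> 'a set" where
  "unit_ball_on V \<nu> = {x \<in> V. \<nu> x \<le> 1}"

text \<open>
  A functional on \<open>V\<close> is represented by any function on the ambient type with the right values on \<open>V\<close>;
  its values outside \<open>V\<close> are never used.
\<close>

definition dual_on :: "'a::real_vector set \<Rightarrow> ('a \<Rightarrow> real) \<Rightarrow> ('a \<Rightarrow> real) set" where
  "dual_on V \<nu> = {f.
     (\<forall>x\<in>V. \<forall>y\<in>V. f (x + y) = f x + f y) \<and> (\<forall>c. \<forall>x\<in>V. f (c *\<^sub>R x) = c * f x) \<and>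
     (\<exists>B. \<forall>x\<in>V. \<bar>f x\<bar> \<le> B * \<nu> x)}"

definition dual_norm_on :: "'a::real_vector set \<Rightarrow> ('a \<Rightarrow> real) \<Rightarrow> ('a \<Rightarrow> real) \<Rightarrow> real" where
  "dual_norm_on V \<nu> f = (SUP x\<in>unit_ball_on V \<nu>. \<bar>f x\<bar>)"

text \<open>
  The linear functional whose value at \<open>tensor x\<close> is the product of the values \<open>f i (x i)\<close>
  (lemma \<open>tensor_functional_tensor\<close>), written in coordinates.
\<close>

definition tensor_functional :: "('l::finite \<Rightarrow> 'n::finite set) \<Rightarrow> ('l \<Rightarrow> real ^ 'n \<Rightarrow> real)
    \<Rightarrow> real ^ ('l \<Rightarrow> 'n) \<Rightarrow> real" where
  "tensor_functional J f z =
     (\<Sum>m | \<forall>i. m i \<in> J i. z $ m * (\<Prod>i\<in>UNIV. f i (axis (m i) 1)))"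

lemma functional_coord_space:
  fixes f :: "real ^ 'n::finite \<Rightarrow> real"
  assumes f: "f \<in> dual_on (coord_space I) \<nu>" and x: "x \<in> coord_space I"
  shows "f x = (\<Sum>k\<in>I. x $ k * f (axis k 1))"
proof -
  have f0: "f 0 = 0"
  proof -
    have "f (0 *\<^sub>R x) = 0 * f x" using f x unfolding dual_on_def by blast
    then show ?thesis by simp
  qed
  have sub: "A \<subseteq> I \<Longrightarrow> f (\<Sum>k\<in>A. x $ k *\<^sub>R axis k 1) = (\<Sum>k\<in>A. x $ k * f (axis k 1))" for A
  proof (induction A rule: infinite_finite_induct)
    case (insert j A)
    have ax: "axis k (1::real) \<in> coord_space I" if "k \<in> I" for k
      using that by (auto simp: coord_space_def axis_def)
    have "(\<Sum>k\<in>A. x $ k *\<^sub>R axis k 1) \<in> coord_space I" "x $ j *\<^sub>R axis j 1 \<in> coord_space I"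
      using insert.prems ax subspace_coord_space
      by (auto intro!: subspace_sum subspace_scale)
    moreover have "f (x $ j *\<^sub>R axis j 1) = x $ j * f (axis j 1)"
      using f ax insert.prems by (auto simp: dual_on_def)
    ultimately show ?case
      using insert f by (simp add: dual_on_def)
  qed (auto simp: f0)
  have "x = (\<Sum>k\<in>UNIV. x $ k *\<^sub>R axis k 1)"
    using basis_expansion[of x] by (simp add: scalar_mult_eq_scaleR)
  also have "\<dots> = (\<Sum>k\<in>I. x $ k *\<^sub>R axis k 1)"
    using x by (intro sum.mono_neutral_right) (auto simp: coord_space_def)
  finally show ?thesis using sub[of I] by simp
qed

lemma tensor_functional_tensor:
  fixes x :: "'l::finite \<Rightarrow> real ^ 'n::finite"
  assumes "\<And>i. f i \<in> dual_on (coord_space (J i)) (\<nu> i)" "\<And>i. x i \<in> coord_space (J i)"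
  shows "tensor_functional J f (tensor x) = (\<Prod>i\<in>UNIV. f i (x i))"
proof -
  have "(\<Prod>i\<in>UNIV. f i (x i)) = (\<Prod>i\<in>UNIV. \<Sum>k\<in>J i. x i $ k * f i (axis k 1))"
    using assms by (intro prod.cong refl functional_coord_space)
  also have "\<dots> = (\<Sum>m\<in>PiE UNIV J. \<Prod>i\<in>UNIV. x i $ m i * f i (axis (m i) 1))"
    by (rule prod_sum_PiE) auto
  finally show ?thesis
    by (simp add: tensor_functional_def tensor_def prod.distrib PiE_UNIV_domain Pi_def)
qed

definition reasonable_crossnorm :: "('l::finite \<Rightarrow> 'n::finite set) \<Rightarrow> ('l \<Rightarrow> real ^ 'n \<Rightarrow> real)
    \<Rightarrow> (real ^ ('l \<Rightarrow> 'n) \<Rightarrow> real) \<Rightarrow> bool" where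
  "reasonable_crossnorm J \<nu> \<alpha> \<longleftrightarrow>
     norm_on (tensor_space J) \<alpha> \<and>
     (\<forall>x. (\<forall>i. x i \<in> coord_space (J i)) \<longrightarrow> \<alpha> (tensor x) \<le> (\<Prod>i\<in>UNIV. \<nu> i (x i))) \<and>
     (\<forall>f. (\<forall>i. f i \<in> dual_on (coord_space (J i)) (\<nu> i)) \<longrightarrow>
        tensor_functional J f \<in> dual_on (tensor_space J) \<alpha> \<and>
        dual_norm_on (tensor_space J) \<alpha> (tensor_functional J f)
          \<le> (\<Prod>i\<in>UNIV. dual_norm_on (coord_space (J i)) (\<nu> i) (f i)))"

end

theory Submission
  imports Defs
begin

text \<open>
  The unit balls \<open>B\<^sub>i\<close> of norms on the factors determine whether a norm on the tensor product is a
  reasonable crossnorm: by homogeneity, this holds if and only if its unit ball \<open>Q\<close> lies between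
  the projective and the injective product of the \<open>B\<^sub>i\<close> (lemma \<open>reasonable_crossnorm_iff_between\<close>).
  The theorem thus reduces to comparing the \<open>B\<^sub>i\<close> with the factor bodies of \<open>Q\<close>.

  Suppose that \<open>Q\<close> is the unit ball of a reasonable crossnorm \<open>\<alpha>\<close>. Then \<open>\<alpha>\<close> is multiplicative on
  decomposable tensors, by Hahn--Banach in each factor (lemma \<open>reasonable_crossnorm_tensor\<close>).
  If \<open>tensor a\<close> lies on the boundary of \<open>Q\<close>, that is, has \<open>\<alpha>\<close>-norm 1, then the product of the
  numbers \<open>r\<^sub>i = \<nu>\<^sub>i (a\<^sub>i)\<close> is 1, and replacing \<open>a\<^sub>i\<close> by \<open>x\<close> gives a tensor of norm \<open>\<nu>\<^sub>i x / r\<^sub>i\<close>. So the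
  factor body is \<open>r\<^sub>i B\<^sub>i\<close>. Neither product changes when the bodies are scaled by factors \<open>r\<^sub>i\<close> of
  product 1, and the inclusions for the \<open>B\<^sub>i\<close> become those for the factor bodies.

  Conversely, let \<open>\<alpha>\<close> be the Minkowski functional of \<open>Q\<close>. Choose a boundary point \<open>tensor a\<close>,
  for instance a multiple of a tensor of basis vectors. The factor bodies at \<open>a\<close> are the unit balls
  of the norms \<open>x \<mapsto> \<alpha> (tensor (a(i := x)))\<close>, so the inclusions at this point say that \<open>\<alpha>\<close> is a
  reasonable crossnorm for these norms.
\<close>

section \<open>Norms on a subspace and their functionals\<close>

lemma norm_onD:
  assumes "norm_on V \<nu>"
  shows norm_on_nonneg: "x \<in> V \<Longrightarrow> 0 \<le> \<nu> x"
    and norm_on_eq_0_iff: "x \<in> V \<Longrightarrow> \<nu> x = 0 \<longleftrightarrow> x = 0"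
    and norm_on_scaleR: "x \<in> V \<Longrightarrow> \<nu> (c *\<^sub>R x) = \<bar>c\<bar> * \<nu> x"
    and norm_on_triangle: "x \<in> V \<Longrightarrow> y \<in> V \<Longrightarrow> \<nu> (x + y) \<le> \<nu> x + \<nu> y"
  using assms by (simp_all add: norm_on_def)

lemma normalized_in_unit_ball_on:
  assumes "subspace V" "norm_on V \<nu>" "x \<in> V" "x \<noteq> 0"
  shows "(1 / \<nu> x) *\<^sub>R x \<in> unit_ball_on V \<nu>"
proof -
  have "\<nu> x > 0"
    using norm_on_nonneg[OF assms(2,3)] norm_on_eq_0_iff[OF assms(2,3)] assms(4) by simp
  then show ?thesis
    using assms by (simp add: unit_ball_on_def subspace_scale norm_on_scaleR)
qed

lemma convex_unit_ball_on:
  assumes "subspace V" "norm_on V \<nu>"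
  shows "convex (unit_ball_on V \<nu>)"
proof (rule convexI)
  fix x y and s t :: real
  assume *: "x \<in> unit_ball_on V \<nu>" "y \<in> unit_ball_on V \<nu>" "0 \<le> s" "0 \<le> t" "s + t = 1"
  then have V: "x \<in> V" "y \<in> V" by (auto simp: unit_ball_on_def)
  have "\<nu> (s *\<^sub>R x + t *\<^sub>R y) \<le> s * \<nu> x + t * \<nu> y"
    using norm_on_triangle[OF assms(2), of "s *\<^sub>R x" "t *\<^sub>R y"] V * assms
    by (simp add: norm_on_scaleR subspace_scale)
  also have "\<dots> \<le> s * 1 + t * 1"
    using * by (intro add_mono mult_left_mono) (auto simp: unit_ball_on_def)
  finally show "s *\<^sub>R x + t *\<^sub>R y \<in> unit_ball_on V \<nu>"
    using * V assms(1) by (simp add: unit_ball_on_def subspace_add subspace_scale)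
qed

lemma dual_norm_on_bound:
  assumes "subspace V" "norm_on V \<nu>" "f \<in> dual_on V \<nu>" "x \<in> V"
  shows "\<bar>f x\<bar> \<le> dual_norm_on V \<nu> f * \<nu> x"
proof (cases "x = 0")
  case True
  have "f (0 *\<^sub>R x) = 0 * f x" using assms(3,4) unfolding dual_on_def by blast
  then show ?thesis using True norm_on_eq_0_iff[OF assms(2,4)] by simp
next
  case False
  obtain B where B: "\<And>x. x \<in> V \<Longrightarrow> \<bar>f x\<bar> \<le> B * \<nu> x"
    using assms(3) unfolding dual_on_def by blast
  have "\<bar>f y\<bar> \<le> \<bar>B\<bar>" if "y \<in> unit_ball_on V \<nu>" for y
  proof -
    have y: "y \<in> V" "\<nu> y \<le> 1" using that by (auto simp: unit_ball_on_def)
    have "\<bar>f y\<bar> \<le> \<bar>B\<bar> * \<nu> y"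
      using B[OF y(1)] norm_on_nonneg[OF assms(2) y(1)]
      by (meson abs_ge_self mult_right_mono order_trans)
    also have "\<dots> \<le> \<bar>B\<bar> * 1" using y by (intro mult_left_mono) auto
    finally show ?thesis by simp
  qed
  then have bdd: "bdd_above ((\<lambda>x. \<bar>f x\<bar>) ` unit_ball_on V \<nu>)" by (rule bdd_aboveI2)
  have pos: "\<nu> x > 0"
    using norm_on_nonneg[OF assms(2,4)] norm_on_eq_0_iff[OF assms(2,4)] False by simp
  have "\<bar>f ((1 / \<nu> x) *\<^sub>R x)\<bar> \<le> dual_norm_on V \<nu> f"
    unfolding dual_norm_on_def
    by (rule cSUP_upper[OF normalized_in_unit_ball_on[OF assms(1,2,4) False] bdd])
  moreover have "f ((1 / \<nu> x) *\<^sub>R x) = (1 / \<nu> x) * f x"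
    using assms(3,4) unfolding dual_on_def by blast
  ultimately show ?thesis using pos by (simp add: abs_mult field_simps)
qed

lemma dual_onI:
  assumes "subspace V" "norm_on V \<nu>"
    and "\<And>x y. x \<in> V \<Longrightarrow> y \<in> V \<Longrightarrow> f (x + y) = f x + f y"
    and "\<And>c x. x \<in> V \<Longrightarrow> f (c *\<^sub>R x) = c * f x"
    and "0 \<le> C" "\<And>x. x \<in> V \<Longrightarrow> \<bar>f x\<bar> \<le> C * \<nu> x"
  shows "f \<in> dual_on V \<nu>" "dual_norm_on V \<nu> f \<le> C"
proof -
  show "f \<in> dual_on V \<nu>" unfolding dual_on_def using assms(3-) by blast
  have "0 \<in> unit_ball_on V \<nu>"
    using assms(1) norm_on_eq_0_iff[OF assms(2), of 0] by (auto simp: unit_ball_on_def subspace_0)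
  moreover have "\<bar>f x\<bar> \<le> C" if "x \<in> unit_ball_on V \<nu>" for x
  proof -
    have "\<bar>f x\<bar> \<le> C * \<nu> x" using that assms(6) by (auto simp: unit_ball_on_def)
    also have "\<dots> \<le> C * 1" using that assms(5)
      by (intro mult_left_mono) (auto simp: unit_ball_on_def)
    finally show ?thesis by simp
  qed
  ultimately show "dual_norm_on V \<nu> f \<le> C"
    unfolding dual_norm_on_def by (intro cSUP_least) auto
qed

lemma dual_norm_on_nonneg:
  assumes "subspace V" "norm_on V \<nu>" "f \<in> dual_on V \<nu>" "x \<in> V" "x \<noteq> 0"
  shows "0 \<le> dual_norm_on V \<nu> f"
proof -
  have "\<nu> x > 0"
    using norm_on_nonneg[OF assms(2,4)] norm_on_eq_0_iff[OF assms(2,4)] assms(5) by simp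
  moreover have "0 \<le> dual_norm_on V \<nu> f * \<nu> x"
    using dual_norm_on_bound[OF assms(1-4)] by linarith
  ultimately show ?thesis by (simp add: zero_le_mult_iff)
qed

text \<open>
  The finite-dimensional Hahn--Banach theorem: a unit vector is no relative interior point of the
  unit ball, because stretching it leaves the ball, so a supporting hyperplane passes through it.
  Strictness on the relative interior excludes the hyperplanes that contain the whole of \<open>V\<close>.
\<close>

lemma norming_functional_exists:
  fixes V :: "'a::euclidean_space set"
  assumes V: "subspace V" and \<nu>: "norm_on V \<nu>" and x: "x \<in> V" "x \<noteq> 0"
  obtains f where "f \<in> dual_on V \<nu>" "dual_norm_on V \<nu> f \<le> 1" "f x = \<nu> x"
proof -
  define B where "B = unit_ball_on V \<nu>"
  define u where "u = (1 / \<nu> x) *\<^sub>R x"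
  have pos: "\<nu> x > 0"
    using norm_on_nonneg[OF \<nu> x(1)] norm_on_eq_0_iff[OF \<nu> x(1)] x(2) by simp
  have uV: "u \<in> V" and \<nu>u: "\<nu> u = 1"
    using V x pos by (auto simp: u_def subspace_scale norm_on_scaleR[OF \<nu> x(1)])
  have B: "convex B" "u \<in> B" "0 \<in> B"
    using convex_unit_ball_on[OF V \<nu>] uV \<nu>u norm_on_eq_0_iff[OF \<nu>, of 0] V
    by (auto simp: B_def unit_ball_on_def subspace_0)
  have not_int: "u \<notin> rel_interior B"
  proof
    assume "u \<in> rel_interior B"
    then obtain e where "e > 1" "(1 - e) *\<^sub>R 0 + e *\<^sub>R u \<in> B"
      using convex_rel_interior_iff[of B u] B by blast
    then show False using norm_on_scaleR[OF \<nu> uV, of e] \<nu>u by (simp add: B_def unit_ball_on_def)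
  qed
  obtain a where a: "\<And>y. y \<in> B \<Longrightarrow> a \<bullet> u \<le> a \<bullet> y"
      "\<And>y. y \<in> rel_interior B \<Longrightarrow> a \<bullet> u < a \<bullet> y"
    using supporting_hyperplane_rel_boundary[OF B(1,2) not_int] by metis
  have abs: "\<bar>a \<bullet> y\<bar> \<le> - (a \<bullet> u)" if "y \<in> B" for y
  proof -
    have "- y \<in> B"
      using that V norm_on_scaleR[OF \<nu>, of y "-1"]
      by (auto simp: B_def unit_ball_on_def subspace_neg)
    then show ?thesis
      using a(1)[of y] a(1)[of "- y"] that by (auto simp: abs_if)
  qed
  have neg: "a \<bullet> u < 0"
  proof -
    obtain w where w: "w \<in> rel_interior B" using rel_interior_eq_empty[OF B(1)] B by auto
    then show ?thesis using a(2)[OF w] abs[of w] rel_interior_subset[of B] by auto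
  qed
  define f where "f y = (a \<bullet> y) / (a \<bullet> u)" for y
  have bound: "\<bar>f y\<bar> \<le> 1 * \<nu> y" if "y \<in> V" for y
  proof (cases "y = 0")
    case False
    have "\<nu> y > 0"
      using norm_on_nonneg[OF \<nu> that] norm_on_eq_0_iff[OF \<nu> that] False by simp
    moreover have "\<bar>a \<bullet> ((1 / \<nu> y) *\<^sub>R y)\<bar> \<le> - (a \<bullet> u)"
      by (rule abs, unfold B_def) (rule normalized_in_unit_ball_on[OF V \<nu> that False])
    ultimately show ?thesis using neg by (simp add: f_def field_simps abs_mult)
  qed (use norm_on_nonneg[OF \<nu> that] in \<open>simp add: f_def\<close>)
  have "f \<in> dual_on V \<nu>" "dual_norm_on V \<nu> f \<le> 1"
    by (rule dual_onI[OF V \<nu> _ _ _ bound];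
        simp add: f_def inner_add_right add_divide_distrib)+
  moreover have "f x = \<nu> x"
  proof -
    have "x = \<nu> x *\<^sub>R u" using pos by (simp add: u_def)
    then have "a \<bullet> x = \<nu> x * (a \<bullet> u)" by (metis inner_scaleR_right)
    then show ?thesis using neg by (simp add: f_def)
  qed
  ultimately show ?thesis by (rule that)
qed

section \<open>Symmetric convex bodies as unit balls\<close>

text \<open>
  With a ball around \<open>u\<close>, a symmetric body contains the opposite ball around \<open>- u\<close>, and by convexity
  the ball of the midpoints of the two, which is centred at 0.
\<close>

lemma symmetric_convex_body_contains_ball:
  assumes V: "subspace V" and K: "symmetric_convex_body V K"
  obtains e where "e > 0" "V \<inter> ball 0 e \<subseteq> K"
proof -
  obtain u T where uT: "openin (top_of_set V) T" "u \<in> T" "T \<subseteq> K"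
    using K by (auto simp: symmetric_convex_body_def interior_of_def)
  then obtain e where e: "e > 0" "ball u e \<inter> V \<subseteq> T" by (auto simp: openin_contains_ball)
  have uV: "u \<in> V" using uT openin_subset by fastforce
  have "w \<in> K" if w: "w \<in> V" "norm w < e" for w
  proof -
    have "u + w \<in> K" "u - w \<in> K"
      using w e uT uV V by (auto intro!: subsetD[OF uT(3)] subsetD[OF e(2)]
          simp: dist_norm subspace_add subspace_diff)
    then have "u + w \<in> K" "- (u - w) \<in> K"
      using K unfolding symmetric_convex_body_def by blast+
    then have "(1/2) *\<^sub>R (u + w) + (1/2) *\<^sub>R (- (u - w)) \<in> K"
      using K unfolding symmetric_convex_body_def by (intro convexD) auto
    moreover have "(1/2) *\<^sub>R (u + w) + (1/2) *\<^sub>R (- (u - w)) = w"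
      by (simp add: algebra_simps flip: scaleR_add_left)
    ultimately show ?thesis by simp
  qed
  then have "V \<inter> ball 0 e \<subseteq> K" by auto
  then show ?thesis by (rule that[OF e(1)])
qed

definition minkowski_functional :: "'a::real_vector set \<Rightarrow> 'a \<Rightarrow> real" where
  "minkowski_functional K x = Inf {t. 0 < t \<and> (1 / t) *\<^sub>R x \<in> K}"

text \<open>
  The admissible \<open>t\<close> form an up-set, since \<open>K\<close> is convex and contains 0; as \<open>K\<close> is closed, a positive
  limit of admissible \<open>t\<close> is admissible. All properties of the functional follow from this description
  of its sublevel sets.
\<close>

lemma minkowski_functional_le_iff:
  assumes V: "subspace V" and K: "symmetric_convex_body V K" and x: "x \<in> V" and s: "0 < s"
  shows "minkowski_functional K x \<le> s \<longleftrightarrow> (1 / s) *\<^sub>R x \<in> K"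
proof -
  define G where "G = {t. 0 < t \<and> (1 / t) *\<^sub>R x \<in> K}"
  obtain e where e: "e > 0" "V \<inter> ball 0 e \<subseteq> K"
    by (rule symmetric_convex_body_contains_ball[OF V K])
  have K0: "0 \<in> K" using e V by (auto simp: subspace_0)
  have up: "r \<in> G" if "t \<in> G" "t \<le> r" for t r
  proof -
    have t: "t > 0" "r > 0" "(1 / t) *\<^sub>R x \<in> K" using that by (auto simp: G_def)
    have "(t / r) *\<^sub>R ((1 / t) *\<^sub>R x) + (1 - t / r) *\<^sub>R 0 \<in> K"
      using K K0 t that unfolding symmetric_convex_body_def by (intro convexD) auto
    then show ?thesis using t by (simp add: G_def)
  qed
  have "(norm x / e + 1) \<in> G"
  proof -
    have "norm x < e * (norm x / e + 1)" using e by (simp add: field_simps)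
    moreover have p: "norm x / e + 1 > 0" using e by (simp add: add_nonneg_pos)
    ultimately have "(1 / (norm x / e + 1)) *\<^sub>R x \<in> V \<inter> ball 0 e"
      using V x by (simp add: subspace_scale pos_divide_less_eq)
    then show ?thesis using e p by (auto simp: G_def)
  qed
  then have ne: "G \<noteq> {}" by auto
  have bdd: "bdd_below G" by (auto simp: G_def intro!: bdd_belowI[of _ 0])
  show ?thesis
  proof
    assume "(1 / s) *\<^sub>R x \<in> K"
    then have "s \<in> G" using s by (simp add: G_def)
    then show "minkowski_functional K x \<le> s"
      using bdd unfolding minkowski_functional_def G_def[symmetric] by (rule cInf_lower)
  next
    assume le: "minkowski_functional K x \<le> s"
    have ev: "(1 / r) *\<^sub>R x \<in> K" if "r > s" for r
    proof -
      have "Inf G < r" using le that by (simp add: minkowski_functional_def G_def)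
      then obtain t where "t \<in> G" "t < r" using cInf_less_iff[OF ne bdd] by blast
      then have "r \<in> G" using up by auto
      then show ?thesis by (simp add: G_def)
    qed
    have "((\<lambda>r. (1 / r) *\<^sub>R x) \<longlongrightarrow> (1 / s) *\<^sub>R x) (at_right s)"
      using s by (intro tendsto_intros) auto
    moreover have "eventually (\<lambda>r. (1 / r) *\<^sub>R x \<in> K) (at_right s)"
      using ev eventually_at_right_less by (rule eventually_mono[rotated])
    moreover have "closed K" using K by (auto simp: symmetric_convex_body_def compact_imp_closed)
    ultimately show "(1 / s) *\<^sub>R x \<in> K"
      by (intro Lim_in_closed_set[of K "\<lambda>r. (1 / r) *\<^sub>R x" "at_right s"]) auto
  qed
qed

lemma minkowski_functional_norm_on:
  assumes V: "subspace V" and K: "symmetric_convex_body V K"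
  shows "norm_on V (minkowski_functional K)"
proof -
  let ?g = "minkowski_functional K"
  note iff = minkowski_functional_le_iff[OF V K]
  have nonneg: "0 \<le> ?g x" if x: "x \<in> V" for x
  proof (rule ccontr)
    assume neg: "\<not> 0 \<le> ?g x"
    have ne: "{t. 0 < t \<and> (1 / t) *\<^sub>R x \<in> K} \<noteq> {}" 
    proof -
      have "(1::real) \<in> {t. 0 < t \<and> (1 / t) *\<^sub>R x \<in> K}" using iff[OF x, of 1] neg by simp
      then show ?thesis by blast
    qed
    have "0 \<le> ?g x"
      unfolding minkowski_functional_def by (rule cInf_greatest[OF ne]) auto
    then show False using neg by simp
  qed
  have K_neg: "- x \<in> K \<longleftrightarrow> x \<in> K" for x
    using K unfolding symmetric_convex_body_def by (metis image_eqI minus_minus)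
  have le_scale: "?g (c *\<^sub>R x) \<le> \<bar>c\<bar> * s" if "x \<in> V" "c \<noteq> 0" "0 < s" "?g x \<le> s" for c x s
  proof -
    have *: "(1 / s) *\<^sub>R x \<in> K" using iff[OF that(1,3)] that(4) by simp
    have "(1 / (\<bar>c\<bar> * s)) *\<^sub>R (c *\<^sub>R x) \<in> K"
    proof (cases "c > 0")
      case False
      have "(1 / (\<bar>c\<bar> * s)) *\<^sub>R (c *\<^sub>R x) = - ((1 / s) *\<^sub>R x)"
        using False that by (simp add: divide_simps)
      then show ?thesis using * K_neg by metis
    qed (use * in simp)
    then show ?thesis using iff[of "c *\<^sub>R x" "\<bar>c\<bar> * s"] that V by (simp add: subspace_scale)
  qed
  \<comment> \<open>Sublevel sets are known only at positive levels, so the value itself is approached from above.\<close>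
  have le_scale': "?g (c *\<^sub>R x) \<le> \<bar>c\<bar> * ?g x" if "x \<in> V" "c \<noteq> 0" for c x
  proof (rule field_le_epsilon)
    fix e :: real assume e: "e > 0"
    have "?g (c *\<^sub>R x) \<le> \<bar>c\<bar> * (?g x + e / \<bar>c\<bar>)"
      using that e nonneg[OF that(1)] by (intro le_scale) (auto simp: add_nonneg_pos)
    then show "?g (c *\<^sub>R x) \<le> \<bar>c\<bar> * ?g x + e" using that by (simp add: algebra_simps)
  qed
  have zero: "?g 0 = 0"
  proof -
    have "(1 / s) *\<^sub>R 0 \<in> K" for s :: real
    proof -
      obtain e where "e > 0" "V \<inter> ball 0 e \<subseteq> K"
        by (rule symmetric_convex_body_contains_ball[OF V K])
      then show ?thesis using V by (auto simp: subspace_0)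
    qed
    then have "?g 0 \<le> 0 + s" if "s > 0" for s using iff[of 0 s] V that by (simp add: subspace_0)
    then have "?g 0 \<le> 0" by (rule field_le_epsilon)
    then show ?thesis using nonneg[of 0] V by (simp add: subspace_0)
  qed
  have scale: "?g (c *\<^sub>R x) = \<bar>c\<bar> * ?g x" if x: "x \<in> V" for c x
  proof (cases "c = 0")
    case False
    have "?g ((1 / c) *\<^sub>R (c *\<^sub>R x)) \<le> \<bar>1 / c\<bar> * ?g (c *\<^sub>R x)"
      using x False V by (intro le_scale') (auto simp: subspace_scale)
    then have "\<bar>c\<bar> * ?g x \<le> ?g (c *\<^sub>R x)" using False by (simp add: field_simps)
    then show ?thesis using le_scale'[OF x False] by simp
  qed (simp add: zero)
  have def0: "x = 0" if x: "x \<in> V" "?g x = 0" for x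
  proof (rule ccontr)
    assume "x \<noteq> 0"
    obtain b where b: "b > 0" "\<And>y. y \<in> K \<Longrightarrow> norm y \<le> b"
      using K compact_imp_bounded[of K] unfolding symmetric_convex_body_def bounded_pos by blast
    define s where "s = norm x / (2 * b)"
    have "s > 0" using \<open>x \<noteq> 0\<close> b by (simp add: s_def)
    then have "(1 / s) *\<^sub>R x \<in> K" using iff[OF x(1)] x(2) by simp
    then have "norm ((1 / s) *\<^sub>R x) \<le> b" by (rule b)
    then show False using \<open>x \<noteq> 0\<close> b by (simp add: s_def)
  qed
  have tri: "?g (x + y) \<le> ?g x + ?g y" if xy: "x \<in> V" "y \<in> V" for x y
  proof (rule field_le_epsilon)
    fix e :: real assume e: "e > 0"
    define s t where "s = ?g x + e / 2" and "t = ?g y + e / 2"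
    have st: "s > 0" "t > 0" using nonneg xy e by (auto simp: s_def t_def add_nonneg_pos)
    have "(1 / s) *\<^sub>R x \<in> K" "(1 / t) *\<^sub>R y \<in> K"
      using iff[OF xy(1) st(1)] iff[OF xy(2) st(2)] e by (auto simp: s_def t_def)
    then have "(s / (s + t)) *\<^sub>R ((1 / s) *\<^sub>R x) + (t / (s + t)) *\<^sub>R ((1 / t) *\<^sub>R y) \<in> K"
      using K st unfolding symmetric_convex_body_def
      by (intro convexD) (auto simp flip: add_divide_distrib)
    then have "(1 / (s + t)) *\<^sub>R (x + y) \<in> K" using st by (simp add: scaleR_add_right)
    then have "?g (x + y) \<le> s + t"
      using iff[of "x + y" "s + t"] st xy V by (simp add: subspace_add)
    then show "?g (x + y) \<le> ?g x + ?g y + e" by (simp add: s_def t_def)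
  qed
  show ?thesis using nonneg zero def0 scale tri by (auto simp: norm_on_def)
qed

lemma unit_ball_on_minkowski_functional:
  assumes "subspace V" "symmetric_convex_body V K"
  shows "unit_ball_on V (minkowski_functional K) = K"
  using minkowski_functional_le_iff[OF assms, of _ 1] assms(2)
  by (auto simp: unit_ball_on_def symmetric_convex_body_def)

text \<open>
  A point of norm less than 1 is interior: if \<open>K\<close> contains the \<open>e\<close>-ball around 0, the triangle
  inequality leaves room for a ball of radius \<open>e * (1 - \<alpha> x)\<close> around \<open>x\<close>. A point of norm 1 leaves \<open>K\<close>
  under any stretching, so it is not interior.
\<close>

lemma frontier_of_unit_ball_on_iff:
  assumes V: "subspace V" and K: "symmetric_convex_body V K"
    and \<alpha>: "norm_on V \<alpha>" and Keq: "K = unit_ball_on V \<alpha>" and x: "x \<in> V"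
  shows "x \<in> (top_of_set V) frontier_of K \<longleftrightarrow> \<alpha> x = 1"
proof -
  have "closedin (top_of_set V) K"
    using K by (intro closed_subset) (auto simp: symmetric_convex_body_def compact_imp_closed)
  then have fr: "(top_of_set V) frontier_of K = K - (top_of_set V) interior_of K"
    by (simp add: frontier_of_def closure_of_closedin)
  have "x \<in> (top_of_set V) interior_of K" if lt: "\<alpha> x < 1"
  proof -
    obtain e where e: "e > 0" "V \<inter> ball 0 e \<subseteq> K"
      by (rule symmetric_convex_body_contains_ball[OF V K])
    have "V \<inter> ball x (e * (1 - \<alpha> x)) \<subseteq> K"
    proof clarify
      fix y assume y: "y \<in> V" "y \<in> ball x (e * (1 - \<alpha> x))"
      define w where "w = (1 / (1 - \<alpha> x)) *\<^sub>R (y - x)"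
      have wV: "w \<in> V" using V x y by (simp add: w_def subspace_scale subspace_diff)
      have "norm w < e"
        using y lt by (simp add: w_def dist_norm norm_minus_commute pos_divide_less_eq)
      then have "\<alpha> w \<le> 1" using e wV by (auto simp: Keq unit_ball_on_def)
      have "y = x + (1 - \<alpha> x) *\<^sub>R w" using lt by (simp add: w_def)
      then have "\<alpha> y \<le> \<alpha> x + \<alpha> ((1 - \<alpha> x) *\<^sub>R w)"
        using norm_on_triangle[OF \<alpha> x] V wV by (simp add: subspace_scale)
      also have "\<dots> = \<alpha> x + (1 - \<alpha> x) * \<alpha> w" using norm_on_scaleR[OF \<alpha> wV] lt by simp
      also have "\<dots> \<le> \<alpha> x + (1 - \<alpha> x) * 1"
        using \<open>\<alpha> w \<le> 1\<close> lt by (intro add_left_mono mult_left_mono) auto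
      finally show "y \<in> K" using y by (simp add: Keq unit_ball_on_def)
    qed
    moreover have "openin (top_of_set V) (V \<inter> ball x (e * (1 - \<alpha> x)))"
      by (simp add: openin_open_Int)
    moreover have "x \<in> V \<inter> ball x (e * (1 - \<alpha> x))" using x e lt by simp
    ultimately show ?thesis unfolding interior_of_def by blast
  qed
  moreover have "x \<notin> (top_of_set V) interior_of K" if eq: "\<alpha> x = 1"
  proof
    assume "x \<in> (top_of_set V) interior_of K"
    then obtain T where T: "openin (top_of_set V) T" "x \<in> T" "T \<subseteq> K"
      by (auto simp: interior_of_def)
    then obtain e where e: "e > 0" "ball x e \<inter> V \<subseteq> T" by (auto simp: openin_contains_ball)
    have "x \<noteq> 0" using eq norm_on_eq_0_iff[OF \<alpha> x] by auto
    define c where "c = 1 + e / (2 * norm x)"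
    have c: "c > 1" using e \<open>x \<noteq> 0\<close> by (simp add: c_def)
    have "dist x (c *\<^sub>R x) = e / 2"
    proof -
      have "x - c *\<^sub>R x = - ((e / (2 * norm x)) *\<^sub>R x)" by (simp add: c_def algebra_simps)
      then show ?thesis using e \<open>x \<noteq> 0\<close> by (simp add: dist_norm)
    qed
    then have "c *\<^sub>R x \<in> ball x e \<inter> V" using e x V by (simp add: subspace_scale)
    then have "c *\<^sub>R x \<in> K" using e T by blast
    then show False
      using norm_on_scaleR[OF \<alpha> x, of c] c eq by (simp add: Keq unit_ball_on_def)
  qed
  moreover have "x \<in> K \<longleftrightarrow> \<alpha> x \<le> 1" using x by (simp add: Keq unit_ball_on_def)
  ultimately show ?thesis unfolding fr by force
qed

section \<open>Decomposable tensors, projective and injective products\<close>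

lemma subspace_tensor_space: "subspace (tensor_space J)"
  by (simp add: tensor_space_def subspace_coord_space)

lemma tensor_scaleR:
  "tensor (\<lambda>i. c i *\<^sub>R x i) = (\<Prod>i\<in>UNIV. c i) *\<^sub>R tensor x"
  by (simp add: tensor_def vec_eq_iff prod.distrib)

lemma tensor_eq_0_iff: "tensor x = 0 \<longleftrightarrow> (\<exists>i. x i = 0)"
proof -
  have "tensor x = 0 \<longleftrightarrow> tensor x \<bullet> tensor x = 0" by simp
  also have "\<dots> \<longleftrightarrow> (\<exists>i. x i = 0)" by (subst inner_tensor) simp
  finally show ?thesis .
qed

text \<open>
  The factors are kept as functions \<open>g j\<close> of the vector in position \<open>j\<close>, so that one identity serves
  both coordinates of tensors and products of norms.
\<close>

lemma prod_fun_upd: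
  fixes g :: "'l::finite \<Rightarrow> 'b \<Rightarrow> 'c::comm_monoid_mult"
  shows "(\<Prod>j\<in>UNIV. g j ((a(i := x)) j)) = g i x * (\<Prod>j\<in>UNIV - {i}. g j (a j))"
  by (subst prod.remove[of UNIV i]) (auto intro!: prod.cong arg_cong2[of _ _ _ _ "(*)"])

lemma tensor_upd_nth:
  "tensor (a(i := x)) $ m = x $ m i * (\<Prod>j\<in>UNIV - {i}. a j $ m j)"
  using prod_fun_upd[of "\<lambda>j v. v $ m j" a i x] by (simp add: tensor_def)

lemma tensor_upd_add: "tensor (a(i := x + y)) = tensor (a(i := x)) + tensor (a(i := y))"
  by (simp only: vec_eq_iff tensor_upd_nth vector_add_component distrib_right) simp

lemma tensor_upd_scaleR: "tensor (a(i := c *\<^sub>R x)) = c *\<^sub>R tensor (a(i := x))"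
  by (simp only: vec_eq_iff tensor_upd_nth vector_scaleR_component) simp

lemma polar_iff: "y \<in> polar V C \<longleftrightarrow> y \<in> V \<and> (\<forall>x\<in>C. \<bar>x \<bullet> y\<bar> \<le> 1)"
  by (simp add: polar_def SUP_le_iff one_ereal_def)

lemma polar_scaleR:
  assumes "subspace V" "0 < r"
  shows "polar V ((\<lambda>x. r *\<^sub>R x) ` K) = (\<lambda>y. (1 / r) *\<^sub>R y) ` polar V K"
proof (intro set_eqI iffI)
  fix y assume "y \<in> polar V ((\<lambda>x. r *\<^sub>R x) ` K)"
  then have "r *\<^sub>R y \<in> polar V K" using assms by (auto simp: polar_iff subspace_scale)
  moreover have "y = (1 / r) *\<^sub>R (r *\<^sub>R y)" using assms by simp
  ultimately show "y \<in> (\<lambda>y. (1 / r) *\<^sub>R y) ` polar V K" by blast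
qed (use assms in \<open>auto simp: polar_iff subspace_scale\<close>)

text \<open>
  Passing to the convex hull does not change a polar set, so the decomposable tensors of polar
  vectors suffice to test membership in the injective product.
\<close>

lemma inj_tensor_iff:
  "z \<in> inj_tensor J K \<longleftrightarrow> z \<in> tensor_space J \<and>
     (\<forall>y. (\<forall>i. y i \<in> polar (coord_space (J i)) (K i)) \<longrightarrow> \<bar>tensor y \<bullet> z\<bar> \<le> 1)"
proof -
  define P where "P = {tensor y | y. \<forall>i. y i \<in> polar (coord_space (J i)) (K i)}"
  have "convex {w. \<bar>w \<bullet> z\<bar> \<le> 1}"
  proof -
    have "{w. \<bar>w \<bullet> z\<bar> \<le> 1} = {w. z \<bullet> w \<le> 1} \<inter> {w. z \<bullet> w \<ge> -1}"
      by (auto simp: inner_commute abs_le_iff)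
    then show ?thesis by (simp add: convex_Int convex_halfspace_le convex_halfspace_ge)
  qed
  then have "convex hull P \<subseteq> {w. \<bar>w \<bullet> z\<bar> \<le> 1} \<longleftrightarrow> P \<subseteq> {w. \<bar>w \<bullet> z\<bar> \<le> 1}"
    using hull_minimal[of P _ convex] hull_subset[of P convex] by blast
  then show ?thesis by (auto simp: inj_tensor_def polar_iff proj_tensor_def P_def)
qed

text \<open>
  The scalars \<open>r i\<close> come out of a tensor as their product. Since polarity inverts
  scalars, the same invariance passes to the injective product.
\<close>

lemma proj_tensor_scaleR:
  assumes "(\<Prod>i\<in>UNIV. r i) = 1"
  shows "proj_tensor (\<lambda>i. (\<lambda>x. r i *\<^sub>R x) ` K i) = proj_tensor K"
proof -
  have "{tensor x | x. \<forall>i. x i \<in> (\<lambda>x. r i *\<^sub>R x) ` K i} = {tensor x | x. \<forall>i. x i \<in> K i}"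
  proof (intro set_eqI iffI)
    fix z assume "z \<in> {tensor x | x. \<forall>i. x i \<in> (\<lambda>x. r i *\<^sub>R x) ` K i}"
    then obtain x where x: "z = tensor x" "\<forall>i. \<exists>b. b \<in> K i \<and> x i = r i *\<^sub>R b" by blast
    then obtain b where b: "\<And>i. b i \<in> K i \<and> x i = r i *\<^sub>R b i" by metis
    then have "x = (\<lambda>i. r i *\<^sub>R b i)" by auto
    then have "z = tensor b" using x(1) assms by (simp add: tensor_scaleR)
    then show "z \<in> {tensor x | x. \<forall>i. x i \<in> K i}" using b by blast
  next
    fix z assume "z \<in> {tensor x | x. \<forall>i. x i \<in> K i}"
    then obtain b where b: "z = tensor b" "\<And>i. b i \<in> K i" by blast
    then have "z = tensor (\<lambda>i. r i *\<^sub>R b i)" using assms by (simp add: tensor_scaleR)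
    then show "z \<in> {tensor x | x. \<forall>i. x i \<in> (\<lambda>x. r i *\<^sub>R x) ` K i}" using b by blast
  qed
  then show ?thesis by (simp add: proj_tensor_def)
qed

lemma inj_tensor_scaleR:
  assumes "\<And>i. 0 < r i" "(\<Prod>i\<in>UNIV. r i) = 1"
  shows "inj_tensor J (\<lambda>i. (\<lambda>x. r i *\<^sub>R x) ` K i) = inj_tensor J K"
proof -
  have "(\<Prod>i\<in>UNIV. 1 / r i) = 1" using assms(2) by (simp add: prod_dividef)
  then show ?thesis
    unfolding inj_tensor_def polar_scaleR[OF subspace_coord_space assms(1)]
    by (simp add: proj_tensor_scaleR)
qed

section \<open>Reasonable crossnorms\<close>

lemma tensor_functional_eq_inner:
  assumes "\<And>i k. k \<in> J i \<Longrightarrow> y i $ k = f i (axis k 1)" and z: "z \<in> tensor_space J"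
  shows "tensor_functional J f z = tensor y \<bullet> z"
proof -
  have "tensor y \<bullet> z = (\<Sum>m\<in>UNIV. z $ m * (\<Prod>i\<in>UNIV. y i $ m i))"
    by (simp add: inner_vec_def tensor_def mult.commute)
  also have "\<dots> = (\<Sum>m | \<forall>i. m i \<in> J i. z $ m * (\<Prod>i\<in>UNIV. y i $ m i))"
    using z by (intro sum.mono_neutral_right) (auto simp: tensor_space_def coord_space_def)
  also have "\<dots> = tensor_functional J f z"
    unfolding tensor_functional_def using assms(1) by (intro sum.cong refl) simp
  finally show ?thesis by simp
qed

lemma axis_in_coord_space: "k \<in> I \<Longrightarrow> axis k (1::real) \<in> coord_space I"
  by (auto simp: coord_space_def axis_def)

text \<open>
  Reasonableness is a sandwich condition on the unit ball. Condition (1) of a reasonable crossnorm,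
  restricted to unit vectors, is the lower inclusion. Condition (2), restricted to functionals of
  norm at most 1, that is, to elements of the polar bodies, is the upper inclusion. Homogeneity
  recovers both conditions from these restrictions.
\<close>

lemma reasonable_crossnorm_iff_between:
  fixes J :: "'l::finite \<Rightarrow> 'n::finite set"
  assumes J: "\<And>i. J i \<noteq> {}"
    and \<nu>: "\<And>i. norm_on (coord_space (J i)) (\<nu> i)"
    and \<alpha>: "norm_on (tensor_space J) \<alpha>"
  shows "reasonable_crossnorm J \<nu> \<alpha> \<longleftrightarrow>
     proj_tensor (\<lambda>i. unit_ball_on (coord_space (J i)) (\<nu> i)) \<subseteq> unit_ball_on (tensor_space J) \<alpha> \<and>
     unit_ball_on (tensor_space J) \<alpha> \<subseteq> inj_tensor J (\<lambda>i. unit_ball_on (coord_space (J i)) (\<nu> i))"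
    (is "_ \<longleftrightarrow> proj_tensor ?B \<subseteq> ?Q \<and> ?Q \<subseteq> inj_tensor J ?B")
proof
  let ?V = "\<lambda>i. coord_space (J i)" and ?T = "tensor_space J"
  note sV = subspace_coord_space and sT = subspace_tensor_space[of J]
  assume r: "reasonable_crossnorm J \<nu> \<alpha>"
  have "proj_tensor ?B \<subseteq> ?Q"
    unfolding proj_tensor_def
  proof (rule hull_minimal)
    show "convex ?Q" by (rule convex_unit_ball_on[OF sT \<alpha>])
    show "{tensor x | x. \<forall>i. x i \<in> ?B i} \<subseteq> ?Q"
    proof clarify
      fix x assume x: "\<forall>i. x i \<in> ?B i"
      then have xV: "x i \<in> ?V i" and le: "\<nu> i (x i) \<le> 1" for i
        by (auto simp: unit_ball_on_def)
      have "\<alpha> (tensor x) \<le> (\<Prod>i\<in>UNIV. \<nu> i (x i))"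
        using r xV by (simp add: reasonable_crossnorm_def)
      also have "\<dots> \<le> 1" using le norm_on_nonneg[OF \<nu> xV] by (intro prod_le_1) auto
      finally show "tensor x \<in> ?Q"
        using tensor_in_tensor_space[of x J, OF xV] by (simp add: unit_ball_on_def)
    qed
  qed
  moreover have "?Q \<subseteq> inj_tensor J ?B"
  proof
    fix z assume "z \<in> ?Q"
    then have z: "z \<in> ?T" "\<alpha> z \<le> 1" by (auto simp: unit_ball_on_def)
    have "\<bar>tensor y \<bullet> z\<bar> \<le> 1" if y: "\<forall>i. y i \<in> polar (?V i) (?B i)" for y
    proof -
      define f where "f i x = y i \<bullet> x" for i x
      have bound: "\<bar>f i x\<bar> \<le> 1 * \<nu> i x" if x: "x \<in> ?V i" for i x
      proof (cases "x = 0")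
        case False
        have "\<nu> i x > 0"
          using norm_on_nonneg[OF \<nu> x] norm_on_eq_0_iff[OF \<nu> x] False by simp
        moreover have "\<bar>((1 / \<nu> i x) *\<^sub>R x) \<bullet> y i\<bar> \<le> 1"
          using y normalized_in_unit_ball_on[OF sV \<nu> x False] unfolding polar_iff by blast
        ultimately show ?thesis by (simp add: f_def abs_mult field_simps inner_commute)
      qed (use norm_on_nonneg[OF \<nu> x] in \<open>simp add: f_def\<close>)
      have f: "f i \<in> dual_on (?V i) (\<nu> i)" "dual_norm_on (?V i) (\<nu> i) (f i) \<le> 1" for i
        by (rule dual_onI[OF sV \<nu> _ _ _ bound]; simp add: f_def inner_add_right)+
      have f0: "0 \<le> dual_norm_on (?V i) (\<nu> i) (f i)" for i
      proof -
        obtain k where "k \<in> J i" using J by blast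
        then show ?thesis
          by (intro dual_norm_on_nonneg[OF sV \<nu> f(1) axis_in_coord_space]) auto
      qed
      have F: "tensor_functional J f \<in> dual_on ?T \<alpha>"
        and "dual_norm_on ?T \<alpha> (tensor_functional J f)
               \<le> (\<Prod>i\<in>UNIV. dual_norm_on (?V i) (\<nu> i) (f i))"
        using r f by (auto simp: reasonable_crossnorm_def)
      note this(2)
      also have "(\<Prod>i\<in>UNIV. dual_norm_on (?V i) (\<nu> i) (f i)) \<le> 1"
        using f f0 by (intro prod_le_1) auto
      finally have "dual_norm_on ?T \<alpha> (tensor_functional J f) * \<alpha> z \<le> 1 * 1"
        using z norm_on_nonneg[OF \<alpha> z(1)] by (intro mult_mono) auto
      then have "\<bar>tensor_functional J f z\<bar> \<le> 1"
        using dual_norm_on_bound[OF sT \<alpha> F z(1)] by linarith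
      moreover have "tensor_functional J f z = tensor y \<bullet> z"
        by (rule tensor_functional_eq_inner[OF _ z(1)]) (simp add: f_def inner_axis)
      ultimately show ?thesis by simp
    qed
    then show "z \<in> inj_tensor J ?B" using z by (simp add: inj_tensor_iff)
  qed
  ultimately show "proj_tensor ?B \<subseteq> ?Q \<and> ?Q \<subseteq> inj_tensor J ?B" ..
next
  let ?V = "\<lambda>i. coord_space (J i)" and ?T = "tensor_space J"
  note sV = subspace_coord_space and sT = subspace_tensor_space[of J]
  assume b: "proj_tensor ?B \<subseteq> ?Q \<and> ?Q \<subseteq> inj_tensor J ?B"
  have proj: "\<alpha> (tensor x) \<le> 1" if "\<And>i. x i \<in> ?B i" for x
  proof -
    have "tensor x \<in> proj_tensor ?B" unfolding proj_tensor_def using that by (blast intro: hull_inc)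
    then show ?thesis using b by (auto simp: unit_ball_on_def)
  qed
  have c1: "\<alpha> (tensor x) \<le> (\<Prod>i\<in>UNIV. \<nu> i (x i))" if x: "\<And>i. x i \<in> ?V i" for x
  proof (cases "\<exists>i. x i = 0")
    case True
    then have "tensor x = 0" by (simp add: tensor_eq_0_iff)
    then have "\<alpha> (tensor x) = 0" using norm_on_eq_0_iff[OF \<alpha> subspace_0[OF sT]] by simp
    then show ?thesis using norm_on_nonneg[OF \<nu> x] by (simp add: prod_nonneg)
  next
    case False
    define u where "u i = (1 / \<nu> i (x i)) *\<^sub>R x i" for i
    have pos: "\<nu> i (x i) > 0" for i
      using norm_on_nonneg[OF \<nu> x, of i] norm_on_eq_0_iff[OF \<nu> x, of i] False by auto
    have u: "u i \<in> ?B i" for i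
      unfolding u_def using False by (intro normalized_in_unit_ball_on[OF sV \<nu> x]) auto
    have uT: "tensor u \<in> ?T"
      using u by (intro tensor_in_tensor_space) (auto simp: unit_ball_on_def)
    have "x = (\<lambda>i. \<nu> i (x i) *\<^sub>R u i)"
      using pos by (auto simp: u_def fun_eq_iff less_imp_neq[symmetric])
    then have "tensor x = (\<Prod>i\<in>UNIV. \<nu> i (x i)) *\<^sub>R tensor u"
      using tensor_scaleR[of "\<lambda>i. \<nu> i (x i)" u] by simp
    then have "\<alpha> (tensor x) = \<bar>\<Prod>i\<in>UNIV. \<nu> i (x i)\<bar> * \<alpha> (tensor u)"
      using norm_on_scaleR[OF \<alpha> uT] by simp
    also have "\<dots> \<le> \<bar>\<Prod>i\<in>UNIV. \<nu> i (x i)\<bar> * 1"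
      using proj[OF u] by (intro mult_left_mono) auto
    also have "\<dots> = (\<Prod>i\<in>UNIV. \<nu> i (x i))"
      using pos by (simp add: prod_nonneg less_imp_le)
    finally show ?thesis .
  qed
  have inj: "\<bar>tensor u \<bullet> z\<bar> \<le> \<alpha> z" if u: "\<And>i. u i \<in> polar (?V i) (?B i)" and z: "z \<in> ?T" for u z
  proof (cases "z = 0")
    case False
    have "\<alpha> z > 0"
      using norm_on_nonneg[OF \<alpha> z] norm_on_eq_0_iff[OF \<alpha> z] False by simp
    moreover have "(1 / \<alpha> z) *\<^sub>R z \<in> inj_tensor J ?B"
      using b normalized_in_unit_ball_on[OF sT \<alpha> z False] by blast
    then have "\<bar>tensor u \<bullet> ((1 / \<alpha> z) *\<^sub>R z)\<bar> \<le> 1" using u unfolding inj_tensor_iff by blast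
    ultimately show ?thesis by (simp add: abs_mult field_simps)
  qed (use norm_on_nonneg[OF \<alpha> z] in simp)
  have c2: "tensor_functional J f \<in> dual_on ?T \<alpha> \<and>
      dual_norm_on ?T \<alpha> (tensor_functional J f) \<le> (\<Prod>i\<in>UNIV. dual_norm_on (?V i) (\<nu> i) (f i))"
    if f: "\<And>i. f i \<in> dual_on (?V i) (\<nu> i)" for f
  proof -
    define c where "c i = dual_norm_on (?V i) (\<nu> i) (f i)" for i
    \<comment> \<open>The Riesz representers of the functionals in the coordinate subspaces.\<close>
    define y :: "'l \<Rightarrow> real ^ 'n" where "y i = (\<chi> k. if k \<in> J i then f i (axis k 1) else 0)" for i
    have c0: "0 \<le> c i" for i
    proof -
      obtain k where "k \<in> J i" using J by blast
      then show ?thesis unfolding c_def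
        by (intro dual_norm_on_nonneg[OF sV \<nu> f axis_in_coord_space]) auto
    qed
    have yV: "y i \<in> ?V i" for i by (simp add: y_def coord_space_def)
    have fy: "f i x = x \<bullet> y i" if x: "x \<in> ?V i" for i x
    proof -
      have "f i x = (\<Sum>k\<in>J i. x $ k * f i (axis k 1))" by (rule functional_coord_space[OF f x])
      also have "\<dots> = (\<Sum>k\<in>J i. x $ k * y i $ k)" by (simp add: y_def)
      also have "\<dots> = (\<Sum>k\<in>UNIV. x $ k * y i $ k)"
        using x by (intro sum.mono_neutral_left) (auto simp: coord_space_def)
      finally show ?thesis by (simp add: inner_vec_def)
    qed
    have F: "tensor_functional J f z = tensor y \<bullet> z" if "z \<in> ?T" for z
      by (rule tensor_functional_eq_inner[OF _ that]) (simp add: y_def)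
    have bound: "\<bar>tensor_functional J f z\<bar> \<le> (\<Prod>i\<in>UNIV. c i) * \<alpha> z" if z: "z \<in> ?T" for z
    proof (cases "\<exists>i. c i = 0")
      case True
      \<comment> \<open>A functional of norm 0 cannot be normalized, but the tensor of the representers is then 0.\<close>
      then obtain i where i: "c i = 0" ..
      have "\<bar>f i (y i)\<bar> \<le> 0"
        using dual_norm_on_bound[OF sV \<nu> f yV, of i] i by (simp add: c_def)
      then have "y i \<bullet> y i = 0" using fy[OF yV, of i] inner_ge_zero[of "y i"] by linarith
      then have "tensor y = 0" by (auto simp: tensor_eq_0_iff)
      then show ?thesis
        using F[OF z] c0 norm_on_nonneg[OF \<alpha> z] by (simp add: prod_nonneg)
    next
      case False
      have pos: "c i > 0" for i using c0[of i] False by (metis less_eq_real_def)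
      define u where "u i = (1 / c i) *\<^sub>R y i" for i
      have u: "u i \<in> polar (?V i) (?B i)" for i
      proof -
        have "\<bar>x \<bullet> u i\<bar> \<le> 1" if "x \<in> ?B i" for x
        proof -
          have x: "x \<in> ?V i" "\<nu> i x \<le> 1" using that by (auto simp: unit_ball_on_def)
          have "\<bar>f i x\<bar> \<le> c i * \<nu> i x"
            unfolding c_def by (rule dual_norm_on_bound[OF sV \<nu> f x(1)])
          also have "\<dots> \<le> c i * 1" using x pos[of i] by (intro mult_left_mono) auto
          finally show ?thesis using pos[of i] fy[OF x(1)] by (simp add: u_def)
        qed
        then show ?thesis using yV by (simp add: polar_iff u_def sV subspace_scale)
      qed
      have "y = (\<lambda>i. c i *\<^sub>R u i)"
        using pos by (auto simp: u_def fun_eq_iff less_imp_neq[symmetric])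
      then have "tensor y = (\<Prod>i\<in>UNIV. c i) *\<^sub>R tensor u"
        using tensor_scaleR[of c u] by simp
      then show ?thesis
        using F[OF z] inj[OF u z] c0 by (simp add: abs_mult prod_nonneg mult_left_mono)
    qed
    have "tensor_functional J f \<in> dual_on ?T \<alpha>"
      "dual_norm_on ?T \<alpha> (tensor_functional J f) \<le> (\<Prod>i\<in>UNIV. c i)"
      by (rule dual_onI[OF sT \<alpha> _ _ _ bound];
          simp add: F subspace_add[OF sT] subspace_scale[OF sT] inner_add_right prod_nonneg c0)+
    then show ?thesis by (simp add: c_def)
  qed
  show "reasonable_crossnorm J \<nu> \<alpha>"
    using \<alpha> c1 c2 by (simp add: reasonable_crossnorm_def)
qed

text \<open>
  The two conditions bound the norm of a decomposable tensor from both sides: the lower bound comes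
  from testing against a tensor product of norming functionals of the factors.
\<close>

lemma reasonable_crossnorm_tensor:
  fixes J :: "'l::finite \<Rightarrow> 'n::finite set"
  assumes \<nu>: "\<And>i. norm_on (coord_space (J i)) (\<nu> i)" and r: "reasonable_crossnorm J \<nu> \<alpha>"
    and x: "\<And>i. x i \<in> coord_space (J i)"
  shows "\<alpha> (tensor x) = (\<Prod>i\<in>UNIV. \<nu> i (x i))"
proof (rule antisym)
  let ?V = "\<lambda>i. coord_space (J i)" and ?T = "tensor_space J"
  note sV = subspace_coord_space and sT = subspace_tensor_space[of J]
  show "\<alpha> (tensor x) \<le> (\<Prod>i\<in>UNIV. \<nu> i (x i))" using r x by (simp add: reasonable_crossnorm_def)
  have \<alpha>: "norm_on ?T \<alpha>" using r by (simp add: reasonable_crossnorm_def)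
  have xT: "tensor x \<in> ?T" by (rule tensor_in_tensor_space[of x J, OF x])
  show "(\<Prod>i\<in>UNIV. \<nu> i (x i)) \<le> \<alpha> (tensor x)"
  proof (cases "\<exists>i. x i = 0")
    case True
    then obtain i where "\<nu> i (x i) = 0" using norm_on_eq_0_iff[OF \<nu> x] by blast
    then have "(\<Prod>i\<in>UNIV. \<nu> i (x i)) = 0" by (intro prod_zero) auto
    also have "0 \<le> \<alpha> (tensor x)" by (rule norm_on_nonneg[OF \<alpha> xT])
    finally show ?thesis .
  next
    case False
    have "\<exists>g. g \<in> dual_on (?V i) (\<nu> i) \<and> dual_norm_on (?V i) (\<nu> i) g \<le> 1 \<and> g (x i) = \<nu> i (x i)" for i
      using norming_functional_exists[OF sV \<nu> x, of i] False by metis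
    then obtain f where f: "\<And>i. f i \<in> dual_on (?V i) (\<nu> i)"
        "\<And>i. dual_norm_on (?V i) (\<nu> i) (f i) \<le> 1" "\<And>i. f i (x i) = \<nu> i (x i)"
      by metis
    have f0: "0 \<le> dual_norm_on (?V i) (\<nu> i) (f i)" for i
      using False by (intro dual_norm_on_nonneg[OF sV \<nu> f(1) x]) auto
    have F: "tensor_functional J f \<in> dual_on ?T \<alpha>"
      and F_le: "dual_norm_on ?T \<alpha> (tensor_functional J f)
             \<le> (\<Prod>i\<in>UNIV. dual_norm_on (?V i) (\<nu> i) (f i))"
      using r f by (auto simp: reasonable_crossnorm_def)
    note F_le
    also have "(\<Prod>i\<in>UNIV. dual_norm_on (?V i) (\<nu> i) (f i)) \<le> 1"
      using f f0 by (intro prod_le_1) auto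
    finally have "dual_norm_on ?T \<alpha> (tensor_functional J f) * \<alpha> (tensor x) \<le> 1 * \<alpha> (tensor x)"
      using norm_on_nonneg[OF \<alpha> xT] by (intro mult_right_mono) auto
    then have "tensor_functional J f (tensor x) \<le> \<alpha> (tensor x)"
      using dual_norm_on_bound[OF sT \<alpha> F xT] by linarith
    then show ?thesis using tensor_functional_tensor[of f J \<nu> x, OF f(1) x] f(3) by simp
  qed
qed

text \<open>
  Since \<open>\<alpha>\<close> is multiplicative and the norms of the \<open>a i\<close> have product 1, replacing \<open>a i\<close> by \<open>x\<close> in
  \<open>tensor a\<close> turns the norm 1 into \<open>\<nu> i x / \<nu> i (a i)\<close>.
\<close>

lemma reasonable_crossnorm_factor_body:
  fixes J :: "'l::finite \<Rightarrow> 'n::finite set"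
  assumes \<nu>: "\<And>i. norm_on (coord_space (J i)) (\<nu> i)" and r: "reasonable_crossnorm J \<nu> \<alpha>"
    and a: "\<And>i. a i \<in> coord_space (J i)" and a1: "\<alpha> (tensor a) = 1"
  shows "0 < \<nu> i (a i)"
    and "factor_body J (unit_ball_on (tensor_space J) \<alpha>) a i
           = (\<lambda>x. \<nu> i (a i) *\<^sub>R x) ` unit_ball_on (coord_space (J i)) (\<nu> i)"
proof -
  have prod: "(\<Prod>i\<in>UNIV. \<nu> i (a i)) = 1"
    using reasonable_crossnorm_tensor[where \<nu>=\<nu> and x=a, OF \<nu> r a] a1 by simp
  then have "\<nu> i (a i) \<noteq> 0" using prod_zero_iff[of UNIV "\<lambda>i. \<nu> i (a i)"] by auto
  then show pos: "0 < \<nu> i (a i)" using norm_on_nonneg[OF \<nu> a, of i] by simp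
  have upd: "\<alpha> (tensor (a(i := x))) = \<nu> i x / \<nu> i (a i)" if x: "x \<in> coord_space (J i)" for x
  proof -
    have "\<alpha> (tensor (a(i := x))) = (\<Prod>j\<in>UNIV. \<nu> j ((a(i := x)) j))"
      using x a by (intro reasonable_crossnorm_tensor[OF \<nu> r]) auto
    also have "\<dots> = \<nu> i x * (\<Prod>j\<in>UNIV - {i}. \<nu> j (a j))" by (rule prod_fun_upd)
    also have "\<dots> = \<nu> i x / \<nu> i (a i)"
      using prod pos prod.remove[of UNIV i "\<lambda>j. \<nu> j (a j)"] by (simp add: field_simps)
    finally show ?thesis .
  qed
  have T: "tensor (a(i := x)) \<in> tensor_space J" if "x \<in> coord_space (J i)" for x
    using that a by (intro tensor_in_tensor_space) auto
  show "factor_body J (unit_ball_on (tensor_space J) \<alpha>) a i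
           = (\<lambda>x. \<nu> i (a i) *\<^sub>R x) ` unit_ball_on (coord_space (J i)) (\<nu> i)" (is "?L = ?R")
  proof (intro set_eqI iffI)
    fix x assume "x \<in> ?L"
    then have x: "x \<in> coord_space (J i)" "\<nu> i x \<le> \<nu> i (a i)"
      using upd pos by (auto simp: factor_body_def unit_ball_on_def)
    then have "(1 / \<nu> i (a i)) *\<^sub>R x \<in> unit_ball_on (coord_space (J i)) (\<nu> i)"
      using pos norm_on_scaleR[OF \<nu> x(1)]
      by (simp add: unit_ball_on_def subspace_scale subspace_coord_space)
    moreover have "x = \<nu> i (a i) *\<^sub>R ((1 / \<nu> i (a i)) *\<^sub>R x)" using pos by simp
    ultimately show "x \<in> ?R" by blast
  next
    fix x assume "x \<in> ?R"
    then obtain w where w: "w \<in> coord_space (J i)" "\<nu> i w \<le> 1" "x = \<nu> i (a i) *\<^sub>R w"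
      by (auto simp: unit_ball_on_def)
    then have "x \<in> coord_space (J i)" by (simp add: subspace_scale subspace_coord_space)
    then show "x \<in> ?L"
      using w pos upd T norm_on_scaleR[OF \<nu> w(1)] by (simp add: factor_body_def unit_ball_on_def)
  qed
qed

lemma norm_on_tensor_slice:
  fixes J :: "'l::finite \<Rightarrow> 'n::finite set"
  assumes \<alpha>: "norm_on (tensor_space J) \<alpha>"
    and a: "\<And>i. a i \<in> coord_space (J i)" and nz: "\<And>i. a i \<noteq> 0"
  shows "norm_on (coord_space (J i)) (\<lambda>x. \<alpha> (tensor (a(i := x))))"
proof -
  have T: "tensor (a(i := x)) \<in> tensor_space J" if "x \<in> coord_space (J i)" for x
    using that a by (intro tensor_in_tensor_space) auto
  have "tensor (a(i := x)) = 0 \<longleftrightarrow> x = 0" for x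
    unfolding tensor_eq_0_iff using nz by (metis fun_upd_apply)
  then show ?thesis
    unfolding norm_on_def
    using norm_on_nonneg[OF \<alpha> T] norm_on_eq_0_iff[OF \<alpha> T] norm_on_scaleR[OF \<alpha> T]
      norm_on_triangle[OF \<alpha> T T]
    by (simp add: tensor_upd_add tensor_upd_scaleR)
qed

section \<open>The characterization\<close>

lemma unit_decomposable_tensor_exists:
  fixes J :: "'l::finite \<Rightarrow> 'n::finite set"
  assumes J: "\<And>i. J i \<noteq> {}" and \<alpha>: "norm_on (tensor_space J) \<alpha>"
  obtains a where "\<And>i. a i \<in> coord_space (J i)" "\<alpha> (tensor a) = 1"
proof -
  have "\<exists>m. \<forall>i. m i \<in> J i" using J by (intro choice) auto
  then obtain m where m: "\<And>i. m i \<in> J i" by auto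
  define b :: "'l \<Rightarrow> real ^ 'n" where "b i = axis (m i) 1" for i
  have b: "b i \<in> coord_space (J i)" for i unfolding b_def by (rule axis_in_coord_space[OF m])
  have bT: "tensor b \<in> tensor_space J" by (rule tensor_in_tensor_space[of b J, OF b])
  have pos: "\<alpha> (tensor b) > 0"
    using norm_on_nonneg[OF \<alpha> bT] norm_on_eq_0_iff[OF \<alpha> bT]
    by (auto simp: less_le tensor_eq_0_iff b_def)
  fix i0 :: 'l
  define a where "a = b(i0 := (1 / \<alpha> (tensor b)) *\<^sub>R b i0)"
  have "a i \<in> coord_space (J i)" for i
    using b by (simp add: a_def subspace_scale subspace_coord_space)
  moreover have "\<alpha> (tensor a) = 1"
    using pos by (simp add: a_def tensor_upd_scaleR norm_on_scaleR[OF \<alpha> bT])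
  ultimately show ?thesis by (rule that)
qed

theorem theorem3p2:
  fixes J :: "'l::finite \<Rightarrow> 'n::finite set"
    and Q :: "(real ^ ('l \<Rightarrow> 'n)) set"
  assumes "\<And>i. J i \<noteq> {}"
    and "symmetric_convex_body (tensor_space J) Q"
  shows "((\<exists>\<nu> \<alpha>. (\<forall>i. norm_on (coord_space (J i)) (\<nu> i)) \<and> reasonable_crossnorm J \<nu> \<alpha> \<and>
              Q = unit_ball_on (tensor_space J) \<alpha>) \<longleftrightarrow>
          (\<forall>a. (\<forall>i. a i \<in> coord_space (J i)) \<and>
               tensor a \<in> (top_of_set (tensor_space J)) frontier_of Q \<longrightarrow>
             proj_tensor (factor_body J Q a) \<subseteq> Q \<and> Q \<subseteq> inj_tensor J (factor_body J Q a))) \<and>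
         (\<forall>\<nu> \<alpha>. (\<forall>i. norm_on (coord_space (J i)) (\<nu> i)) \<and> reasonable_crossnorm J \<nu> \<alpha> \<and>
              Q = unit_ball_on (tensor_space J) \<alpha> \<longrightarrow>
          (\<forall>a. (\<forall>i. a i \<in> coord_space (J i)) \<and>
               tensor a \<in> (top_of_set (tensor_space J)) frontier_of Q \<longrightarrow>
             (\<forall>i. factor_body J Q a i =
                  (\<lambda>x. \<nu> i (a i) *\<^sub>R x) ` unit_ball_on (coord_space (J i)) (\<nu> i))))"
    (is "((\<exists>\<nu> \<alpha>. ?R \<nu> \<alpha>) \<longleftrightarrow> (\<forall>a. ?F a \<longrightarrow> ?I a)) \<and> _")
proof -
  let ?V = "\<lambda>i. coord_space (J i)" and ?T = "tensor_space J"
  have frontier: "tensor a \<in> (top_of_set ?T) frontier_of Q \<longleftrightarrow> \<alpha> (tensor a) = 1"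
    if "norm_on ?T \<alpha>" "Q = unit_ball_on ?T \<alpha>" "\<And>i. a i \<in> ?V i" for \<alpha> a
    using frontier_of_unit_ball_on_iff[OF subspace_tensor_space assms(2) that(1,2)]
      tensor_in_tensor_space[of a J, OF that(3)] by blast
  have slices: "\<And>i. 0 < \<nu> i (a i)"
      "\<And>i. factor_body J Q a i = (\<lambda>x. \<nu> i (a i) *\<^sub>R x) ` unit_ball_on (?V i) (\<nu> i)"
      "(\<Prod>i\<in>UNIV. \<nu> i (a i)) = 1"
    if R: "?R \<nu> \<alpha>" and a: "?F a" for \<nu> \<alpha> a
  proof -
    have \<nu>: "\<And>i. norm_on (?V i) (\<nu> i)" and r: "reasonable_crossnorm J \<nu> \<alpha>"
      and Q: "Q = unit_ball_on ?T \<alpha>" and aV: "\<And>i. a i \<in> ?V i"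
      using R a by auto
    have a1: "\<alpha> (tensor a) = 1"
      using frontier[of \<alpha> a] r Q aV a by (auto simp: reasonable_crossnorm_def)
    show "\<And>i. 0 < \<nu> i (a i)"
      "\<And>i. factor_body J Q a i = (\<lambda>x. \<nu> i (a i) *\<^sub>R x) ` unit_ball_on (?V i) (\<nu> i)"
      unfolding Q by (rule reasonable_crossnorm_factor_body[where \<nu>=\<nu> and a=a, OF \<nu> r aV a1])+
    show "(\<Prod>i\<in>UNIV. \<nu> i (a i)) = 1"
      using reasonable_crossnorm_tensor[where \<nu>=\<nu> and x=a, OF \<nu> r aV] a1 by simp
  qed
  have "?I a" if R: "?R \<nu> \<alpha>" and a: "?F a" for \<nu> \<alpha> a
  proof -
    note s = slices[OF R a]
    have body: "factor_body J Q a = (\<lambda>i. (\<lambda>x. \<nu> i (a i) *\<^sub>R x) ` unit_ball_on (?V i) (\<nu> i))"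
      by (rule ext) (rule s(2))
    have \<alpha>: "norm_on ?T \<alpha>" using R by (simp add: reasonable_crossnorm_def)
    have "proj_tensor (\<lambda>i. unit_ball_on (?V i) (\<nu> i)) \<subseteq> Q \<and>
        Q \<subseteq> inj_tensor J (\<lambda>i. unit_ball_on (?V i) (\<nu> i))"
      using reasonable_crossnorm_iff_between[of J \<nu> \<alpha>] assms(1) R \<alpha> by simp
    then show ?thesis
      unfolding body proj_tensor_scaleR[OF s(3)] inj_tensor_scaleR[OF s(1,3)] .
  qed
  moreover have "\<exists>\<nu> \<alpha>. ?R \<nu> \<alpha>" if I: "\<forall>a. ?F a \<longrightarrow> ?I a"
  proof -
    define \<alpha> where "\<alpha> = minkowski_functional Q"
    have \<alpha>: "norm_on ?T \<alpha>" and Q: "Q = unit_ball_on ?T \<alpha>"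
      unfolding \<alpha>_def using minkowski_functional_norm_on[OF subspace_tensor_space assms(2)]
        unit_ball_on_minkowski_functional[OF subspace_tensor_space assms(2)] by auto
    obtain a where a: "\<And>i. a i \<in> ?V i" "\<alpha> (tensor a) = 1"
      using unit_decomposable_tensor_exists[OF assms(1) \<alpha>] by blast
    \<comment> \<open>The factor bodies at this boundary point are the unit balls of the required norms.\<close>
    define \<nu> where "\<nu> i x = \<alpha> (tensor (a(i := x)))" for i x
    have "tensor a \<noteq> 0"
      using a(2) norm_on_eq_0_iff[OF \<alpha> subspace_0[OF subspace_tensor_space]] by auto
    then have \<nu>: "norm_on (?V i) (\<nu> i)" for i
      unfolding \<nu>_def using a(1) by (intro norm_on_tensor_slice[OF \<alpha>]) (auto simp: tensor_eq_0_iff)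
    have "factor_body J Q a = (\<lambda>i. unit_ball_on (?V i) (\<nu> i))"
      using a(1) by (auto simp: fun_eq_iff factor_body_def unit_ball_on_def Q \<nu>_def
          intro!: tensor_in_tensor_space)
    moreover have "?I a" using I a frontier[OF \<alpha> Q, of a] by blast
    ultimately have "reasonable_crossnorm J \<nu> \<alpha>"
      using reasonable_crossnorm_iff_between[of J \<nu> \<alpha>] assms(1) \<nu> \<alpha> Q by simp
    then show ?thesis using \<nu> Q by blast
  qed
  ultimately show ?thesis using slices(2) by blast
qed

end
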